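(* Let $M$ be a purely 2-unrectifiable metric space and let $x\in M$. Let $[\alpha]\in\pi_1^{\mathrm{Lip}}(M,x)$ be a homotopy class of Lipschitz loops based at $x$ such that for every open neighborhood $U\subset M$ of $x$ there exists a Lipschitz loop $\alpha_U\in[\alpha]$ based at $x$ whose image is contained in $U$. Then $[\alpha]$ is the trivial homotopy class, i.e. $[\alpha]=[x]$, the class of the constant loop at $x$.
   Context: $I=[0,1]$ with the Euclidean metric; all paths have domain $I$; $I\times I$ carries the $L^1$ metric $d^1((s,t),(s',t'))=|s-s'|+|t-t'|$. A metric space $M$ is purely 2-unrectifiable (in the sense of Ambrosio-Kirchheim) if for every Borel set $S\subset\mathbb{R}^2$ and every Lipschitz map $f:S\to M$, the 2-dimensional Hausdorff measure of $f(S)$ is zero. Two Lipschitz paths $\gamma,\gamma':I\to M$ are homotopic rel endpoints if $\gamma(0)=\gamma'(0)$, $\gamma(1)=\gamma'(1)$, and there is a Lipschitz map $H:I\times I\to M$ with $H(t,0)=\gamma(t)$, $H(t,1)=\gamma'(t)$, $H(0,s)=\gamma(0)$, $H(1,s)=\gamma(1)$ for all $s,t\in I$. The homotopy class $[\gamma]$ is the set of all Lipschitz paths homotopic rel endpoints to $\gamma$. The first Lipschitz homotopy group $\pi_1^{\mathrm{Lip}}(M,x)$ has as elements the homotopy classes of Lipschitz loops based at $x$. *)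

theory Defs
  imports "HOL-Analysis.Analysis"
begin

text \<open>
  The \<open>k\<close>-dimensional Hausdorff (outer) measure of an arbitrary set, normalised so that it agrees
  with Lebesgue measure on Euclidean \<open>k\<close>-space. Covering sets are required to be bounded because
  \<^const>\<open>diameter\<close> is unspecified on unbounded sets. The empty set is given gauge 0
  explicitly, as otherwise \<open>0 ^ 0 = 1\<close> would spoil the case \<open>k = 0\<close>.
  If there is no countable cover by sets of diameter at most \<open>\<delta>\<close>, the infimum is \<open>\<infinity>\<close>.
\<close>

definition hausdorff_gauge :: "nat \<Rightarrow> 'a::metric_space set \<Rightarrow> ennreal" where
  "hausdorff_gauge k U =
     (if U = {} then 0 else ennreal (unit_ball_vol (real k) * (diameter U / 2) ^ k))"

definition hausdorff_premeasure :: "nat \<Rightarrow> real \<Rightarrow> 'a::metric_space set \<Rightarrow> ennreal" where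
  "hausdorff_premeasure k \<delta> A =
     (INF U \<in> {U :: nat \<Rightarrow> 'a set.
                 A \<subseteq> (\<Union>i. U i) \<and> (\<forall>i. bounded (U i) \<and> diameter (U i) \<le> \<delta>)}.
        \<Sum>i. hausdorff_gauge k (U i))"

definition hausdorff_measure :: "nat \<Rightarrow> 'a::metric_space set \<Rightarrow> ennreal" where
  "hausdorff_measure k A = (SUP \<delta> \<in> {0<..}. hausdorff_premeasure k \<delta> A)"

text \<open>
  The space in question is the whole type. A map defined on \<open>S\<close> is represented by
  a total function, of which only the values on \<open>S\<close> matter.
\<close>

definition purely_2_unrectifiable :: "'a::metric_space itself \<Rightarrow> bool" where
  "purely_2_unrectifiable _ \<longleftrightarrow>
     (\<forall>S \<in> sets (borel :: (real^2) measure). \<forall>f :: real^2 \<Rightarrow> 'a.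
        (\<exists>L. L-lipschitz_on S f) \<longrightarrow> hausdorff_measure 2 (f ` S) = 0)"

definition lipschitz_path :: "(real \<Rightarrow> 'a::metric_space) \<Rightarrow> bool" where
  "lipschitz_path \<gamma> \<longleftrightarrow> (\<exists>L. L-lipschitz_on {0..1} \<gamma>)"

definition lipschitz_loop :: "'a::metric_space \<Rightarrow> (real \<Rightarrow> 'a) \<Rightarrow> bool" where
  "lipschitz_loop x \<gamma> \<longleftrightarrow> lipschitz_path \<gamma> \<and> \<gamma> 0 = x \<and> \<gamma> 1 = x"

text \<open>
  The unit square carries the \<open>L\<^sup>1\<close> metric, whereas the product metric of the library is the
  \<open>L\<^sup>2\<close> one, so the Lipschitz condition is written out.
\<close>

definition lipschitz_square :: "(real \<times> real \<Rightarrow> 'a::metric_space) \<Rightarrow> bool" where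
  "lipschitz_square H \<longleftrightarrow>
     (\<exists>L\<ge>0. \<forall>t\<in>{0..1}. \<forall>s\<in>{0..1}. \<forall>t'\<in>{0..1}. \<forall>s'\<in>{0..1}.
        dist (H (t, s)) (H (t', s')) \<le> L * (\<bar>t - t'\<bar> + \<bar>s - s'\<bar>))"

definition lipschitz_homotopic ::
    "(real \<Rightarrow> 'a::metric_space) \<Rightarrow> (real \<Rightarrow> 'a) \<Rightarrow> bool" where
  "lipschitz_homotopic \<gamma> \<gamma>' \<longleftrightarrow>
     lipschitz_path \<gamma> \<and> lipschitz_path \<gamma>' \<and> \<gamma> 0 = \<gamma>' 0 \<and> \<gamma> 1 = \<gamma>' 1 \<and>
     (\<exists>H. lipschitz_square H \<and>
          (\<forall>t\<in>{0..1}. H (t, 0) = \<gamma> t \<and> H (t, 1) = \<gamma>' t) \<and>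
          (\<forall>s\<in>{0..1}. H (0, s) = \<gamma> 0 \<and> H (1, s) = \<gamma> 1))"

text \<open>
  Paths are total functions on the reals whose values outside the unit interval are irrelevant:
  \<^const>\<open>lipschitz_homotopic\<close> ignores them, so a class contains, together with a path, all
  functions agreeing with it on the unit interval.
\<close>

definition lipschitz_class :: "(real \<Rightarrow> 'a::metric_space) \<Rightarrow> (real \<Rightarrow> 'a) set" where
  "lipschitz_class \<gamma> = {\<gamma>'. lipschitz_homotopic \<gamma> \<gamma>'}"

text \<open>The underlying set of the first Lipschitz homotopy group.\<close>

definition lipschitz_pi1 :: "'a::metric_space \<Rightarrow> (real \<Rightarrow> 'a) set set" where
  "lipschitz_pi1 x = lipschitz_class ` {\<gamma>. lipschitz_loop x \<gamma>}"

end

theory Submission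
  imports Defs "HOL-Complex_Analysis.Great_Picard"
begin

text \<open>
  Extend a homotopy from \<open>\<alpha>\<close> to a loop near \<open>x\<close> to a Lipschitz map \<open>f\<close> on the plane and let \<open>K\<close>
  be the part of the plane beyond the other three sides of the square. The height of a point is its
  distance from \<open>K\<close> in the metric of \<open>f\<close>, measured along chains of small mesh. As the height is
  locally a Lipschitz function of the value of \<open>f\<close>, and the range of \<open>f\<close> is null in dimension 2,
  a coarea argument shows that \<open>f\<close> is constant on the components of almost every level set of the
  height. Such a component separates a segment of the bottom side from \<open>K\<close>, so the two ends \<open>s < t\<close> of
  the segment can be joined by descending to it and climbing up again:
  \<open>dist (\<alpha> s) (\<alpha> t) \<le> h s + h t - 2 min h\<close> up to a small error, where \<open>h\<close> is the height along
  the bottom side and the minimum is over \<open>{s..t}\<close>. The Lipschitz constant of \<open>h\<close> is that of \<open>\<alpha>\<close>,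
  so by Arzela-Ascoli the error disappears in the limit of loops shrinking to \<open>x\<close>. A loop with such
  a height factors through a tree, and contracting the tree is an explicit Lipschitz null homotopy.
\<close>

lemma hausdorff_null_cover:
  fixes A :: "'a::metric_space set"
  assumes "hausdorff_measure k A = 0" and "0 < e"
  obtains U where "A \<subseteq> (\<Union>i::nat. U i)" "\<And>i. bounded (U i)" "(\<Sum>i. hausdorff_gauge k (U i)) < ennreal e"
proof -
  have "hausdorff_premeasure k 1 A \<le> hausdorff_measure k A"
    unfolding hausdorff_measure_def by (rule SUP_upper) simp
  then have "hausdorff_premeasure k 1 A < ennreal e"
    using assms by simp
  then show thesis
    unfolding hausdorff_premeasure_def Inf_less_iff using that by auto
qed

lemma negligible_image_if_hausdorff_null:
  fixes f :: "'b \<Rightarrow> 'a::metric_space" and g h :: "'b \<Rightarrow> real"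
  assumes null: "hausdorff_measure 2 A = 0" and fS: "f ` S \<subseteq> A"
    and g: "\<And>p q. p \<in> S \<Longrightarrow> q \<in> S \<Longrightarrow> \<bar>g p - g q\<bar> \<le> dist (f p) (f q)"
    and h: "\<And>p q. p \<in> S \<Longrightarrow> q \<in> S \<Longrightarrow> \<bar>h p - h q\<bar> \<le> dist (f p) (f q)"
  shows "negligible ((\<lambda>p. (g p, h p)) ` S)"
  unfolding negligible_outer_le
proof (intro allI impI)
  fix e :: real assume e: "0 < e"
  obtain U where AU: "A \<subseteq> (\<Union>i::nat. U i)" and bU: "\<And>i. bounded (U i)"
    and sU: "(\<Sum>i. hausdorff_gauge 2 (U i)) < ennreal (e / 16)"
    using hausdorff_null_cover[OF null, of "e / 16"] e by auto
  define c where "c i = (SOME p. p \<in> S \<and> f p \<in> U i)" for i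
  define B where "B i = (if U i = {} then {} else
     cbox (g (c i) - diameter (U i), h (c i) - diameter (U i))
          (g (c i) + diameter (U i), h (c i) + diameter (U i)))" for i
  have "emeasure lborel (B i) \<le> ennreal 16 * hausdorff_gauge 2 (U i)" for i
  proof -
    have d: "0 \<le> diameter (U i)" using bU diameter_ge_0 by blast
    have "emeasure lborel (cbox (g (c i) - diameter (U i), h (c i) - diameter (U i))
          (g (c i) + diameter (U i), h (c i) + diameter (U i))) = ennreal (4 * (diameter (U i))^2)"
      using d by (auto simp: emeasure_lborel_cbox_eq Basis_prod_def inner_Pair power2_eq_square 
          prod.union_disjoint)
    also have "\<dots> \<le> ennreal (16 * (pi * (diameter (U i) / 2) ^ 2))"
      using mult_right_mono[of 1 pi "(diameter (U i))\<^sup>2"] pi_ge_two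
      by (intro ennreal_leI) (simp add: power_divide)
    also have "\<dots> = ennreal 16 * ennreal (pi * (diameter (U i) / 2) ^ 2)"
      by (simp add: ennreal_mult)
    finally show ?thesis
      by (auto simp: B_def hausdorff_gauge_def unit_ball_vol_2)
  qed
  moreover have Bm: "range B \<subseteq> sets lborel"
    by (auto simp: B_def)
  ultimately have "emeasure lborel (\<Union>i. B i) \<le> (\<Sum>i. ennreal 16 * hausdorff_gauge 2 (U i))"
    by (intro order_trans[OF emeasure_subadditive_countably suminf_le]) auto
  also have "\<dots> \<le> ennreal 16 * ennreal (e / 16)"
    unfolding ennreal_suminf_cmult using sU by (intro mult_left_mono) auto
  also have "\<dots> = ennreal e"
    using e by (simp add: ennreal_mult[symmetric] del: ennreal_numeral)
  finally have le: "emeasure lborel (\<Union>i. B i) \<le> ennreal e" .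
  have UB: "(\<Union>i. B i) \<in> sets lborel"
    using Bm by auto
  then have le': "emeasure lebesgue (\<Union>i. B i) \<le> ennreal e"
    using le by simp
  have "(\<lambda>p. (g p, h p)) ` S \<subseteq> (\<Union>i. B i)"
  proof clarify
    fix p assume p: "p \<in> S"
    then have "f p \<in> (\<Union>i. U i)" using fS AU by auto
    then obtain i where i: "f p \<in> U i" by blast
    have ci: "c i \<in> S \<and> f (c i) \<in> U i"
      unfolding c_def using p i by (intro someI[of "\<lambda>p. p \<in> S \<and> f p \<in> U i"]) simp
    have "dist (f p) (f (c i)) \<le> diameter (U i)"
      using diameter_bounded_bound[OF bU] i ci by auto
    moreover have "\<bar>g p - g (c i)\<bar> \<le> dist (f p) (f (c i))" "\<bar>h p - h (c i)\<bar> \<le> dist (f p) (f (c i))"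
      using g h p ci by auto
    ultimately have "(g p, h p) \<in> B i"
      using i by (auto simp: B_def cbox_Pair_eq abs_le_iff)
    then show "(g p, h p) \<in> (\<Union>i. B i)" by blast
  qed
  moreover have "(\<Union>i. B i) \<in> lmeasurable"
    using UB le' by (auto simp: fmeasurable_def top_unique less_top[symmetric])
  moreover have "measure lebesgue (\<Union>i. B i) \<le> e"
    using le' e by (simp add: measure_def enn2real_leI)
  ultimately show "\<exists>T. (\<lambda>p. (g p, h p)) ` S \<subseteq> T \<and> T \<in> lmeasurable \<and> measure lebesgue T \<le> e"
    by blast
qed

lemma negligible_AE_section:
  fixes N :: "(real \<times> real) set"
  assumes "negligible N"
  shows "AE r in lborel. negligible {w. (r, w) \<in> N}"
proof -
  have "N \<in> null_sets lebesgue"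
    using assms by (simp add: negligible_iff_null_sets)
  then obtain N' where "N' \<in> null_sets lborel" "N \<subseteq> N'"
    unfolding null_sets_completion_iff2 by blast
  then have "AE z in lborel. z \<notin> N"
    by (intro AE_I'[of N']) auto
  then have "AE z in lborel \<Otimes>\<^sub>M lborel. z \<notin> N"
    by (subst lborel_prod)
  then have "AE r in lborel. AE w in lborel. (r, w) \<notin> N"
    by (rule lborel_pair.AE_pair)
  then show ?thesis
  proof (rule AE_mp, intro AE_I2 impI)
    fix r assume "AE w in lborel. (r, w) \<notin> N"
    then obtain N' where "N' \<in> null_sets lborel" "{w. (r, w) \<in> N} \<subseteq> N'"
      unfolding eventually_ae_filter by auto
    then show "negligible {w. (r, w) \<in> N}"
      unfolding negligible_iff_null_sets null_sets_completion_iff2 by blast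
  qed
qed

lemma negligible_connected_real:
  fixes W :: "real set"
  assumes "connected W" "negligible W" "a \<in> W" "b \<in> W"
  shows "a = b"
proof (rule ccontr)
  assume ne: "a \<noteq> b"
  define l u where "l = min a b" and "u = max a b"
  have "{l..u} \<subseteq> W"
    using connected_contains_Icc[OF assms(1)] assms(3,4) by (auto simp: l_def u_def min_def max_def)
  then have "negligible {l..u}" using assms(2) negligible_subset by blast
  moreover have "l < u" using ne by (auto simp: l_def u_def)
  ultimately show False
    using negligible_interval(1)[of l u] by (auto simp: box_real)
qed

lemma AE_level_set_constant:
  fixes f :: "'b::euclidean_space \<Rightarrow> 'a::metric_space" and \<rho> :: "'b \<Rightarrow> real"
  assumes null: "hausdorff_measure 2 (range f) = 0"
    and cont: "continuous_on UNIV f"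
    and \<delta>: "0 < \<delta>"
    and \<rho>: "\<And>p q. dist p q \<le> \<delta> \<Longrightarrow> \<bar>\<rho> p - \<rho> q\<bar> \<le> dist (f p) (f q)"
  shows "AE r in lborel. \<forall>C. connected C \<and> C \<subseteq> {p. \<rho> p = r} \<longrightarrow> f constant_on C"
proof -
  obtain D :: "'b set" where D: "countable D" and dense: "\<And>X. open X \<Longrightarrow> X \<noteq> {} \<Longrightarrow> \<exists>d\<in>D. d \<in> X"
    using countable_dense_setE by blast
  have "negligible ((\<lambda>p. (\<rho> p, dist (f y) (f p))) ` UNIV)" for y
  proof -
    have "negligible ((\<lambda>p. (\<rho> p, dist (f y) (f p))) ` ball d (\<delta> / 2))" for d
    proof (rule negligible_image_if_hausdorff_null[OF null])
      fix p q assume "p \<in> ball d (\<delta> / 2)" "q \<in> ball d (\<delta> / 2)"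
      then have "dist p q \<le> \<delta>"
        using dist_triangle_half_r[of d p \<delta> q] by auto
      then show "\<bar>\<rho> p - \<rho> q\<bar> \<le> dist (f p) (f q)" by (rule \<rho>)
      show "\<bar>dist (f y) (f p) - dist (f y) (f q)\<bar> \<le> dist (f p) (f q)"
        by (metis abs_dist_diff_le dist_commute)
    qed auto
    then have "negligible (\<Union>d\<in>D. (\<lambda>p. (\<rho> p, dist (f y) (f p))) ` ball d (\<delta> / 2))"
      using D by (intro negligible_countable_Union) auto
    moreover have "(\<Union>d\<in>D. ball d (\<delta> / 2)) = UNIV"
    proof -
      have "\<exists>d\<in>D. p \<in> ball d (\<delta> / 2)" for p
        using dense[of "ball p (\<delta> / 2)"] \<delta> by (auto simp: dist_commute)
      then show ?thesis by blast
    qed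
    ultimately show ?thesis
      by (metis image_UN)
  qed
  then have "AE r in lborel. \<forall>y\<in>D. negligible {w. (r, w) \<in> range (\<lambda>p. (\<rho> p, dist (f y) (f p)))}"
    unfolding AE_ball_countable[OF D] by (simp add: negligible_AE_section)
  then show ?thesis
  proof (rule AE_mp, intro AE_I2 impI allI)
    fix r C
    assume r: "\<forall>y\<in>D. negligible {w. (r, w) \<in> range (\<lambda>p. (\<rho> p, dist (f y) (f p)))}"
      and C: "connected C \<and> C \<subseteq> {p. \<rho> p = r}"
    have eq: "dist (f y) (f p) = dist (f y) (f q)" if "y \<in> D" "p \<in> C" "q \<in> C" for y p q
    proof (rule negligible_connected_real)
      show "connected ((\<lambda>p. dist (f y) (f p)) ` C)"
        using C cont by (intro connected_continuous_image continuous_intros)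
          (auto intro: continuous_on_subset)
      show "negligible ((\<lambda>p. dist (f y) (f p)) ` C)"
        using r \<open>y \<in> D\<close> C by (elim ballE) (auto elim!: negligible_subset)
    qed (use that in auto)
    have "f p = f q" if "p \<in> C" "q \<in> C" for p q
    proof (rule ccontr)
      assume "f p \<noteq> f q"
      define e where "e = dist (f p) (f q) / 2"
      have "e > 0" using \<open>f p \<noteq> f q\<close> by (simp add: e_def)
      then have "open (f -` ball (f p) e)"
        using cont continuous_on_open_vimage[of UNIV f] by auto
      moreover have "p \<in> f -` ball (f p) e" using \<open>e > 0\<close> by simp
      ultimately obtain d where "d \<in> D" "dist (f p) (f d) < e"
        using dense[of "f -` ball (f p) e"] by (metis empty_iff mem_ball vimage_eq)
      then show False
        using eq[of d p q] that dist_triangle[of "f p" "f q" "f d"] by (simp add: e_def dist_commute)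
    qed
    then show "f constant_on C" unfolding constant_on_def by blast
  qed
qed

lemma lipschitz_on_if_small_scale:
  fixes S :: "'b::real_normed_vector set" and u :: "'b \<Rightarrow> 'a::metric_space"
  assumes S: "convex S" and L: "0 \<le> L" and \<delta>: "0 < \<delta>"
    and small: "\<And>p q. p \<in> S \<Longrightarrow> q \<in> S \<Longrightarrow> dist p q \<le> \<delta> \<Longrightarrow> dist (u p) (u q) \<le> L * dist p q"
  shows "L-lipschitz_on S u"
proof (rule lipschitz_onI)
  have *: "dist (u p) (u q) \<le> L * dist p q"
    if "p \<in> S" "q \<in> S" "dist p q \<le> real n * \<delta>" for n p q
    using that
  proof (induction n arbitrary: p)
    case 0
    then show ?case by simp
  next
    case (Suc n)
    define z where "z = p + (1 / real (Suc n)) *\<^sub>R (q - p)"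
    have z: "z = (1 - 1 / real (Suc n)) *\<^sub>R p + (1 / real (Suc n)) *\<^sub>R q"
      by (simp add: z_def algebra_simps)
    have "z \<in> S"
      unfolding z by (intro convexD[OF S]) (use Suc.prems in \<open>auto simp: divide_simps\<close>)
    have pz: "dist p z = dist p q / real (Suc n)"
      by (simp add: z_def dist_norm norm_minus_commute divide_simps)
    have "z - q = (1 - 1 / real (Suc n)) *\<^sub>R (p - q)"
      by (simp add: z_def algebra_simps)
    then have zq: "dist z q = (1 - 1 / real (Suc n)) * dist p q"
      by (simp add: dist_norm divide_simps)
    have "dist p z \<le> \<delta>"
      using Suc.prems(3) by (simp add: pz divide_simps mult.commute)
    moreover have "dist z q \<le> real n * \<delta>"
    proof -
      have "dist z q = real n * (dist p q / real (Suc n))"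
        by (simp add: zq field_simps)
      also have "\<dots> \<le> real n * \<delta>"
        using Suc.prems(3) by (intro mult_left_mono) (simp_all add: divide_simps mult.commute)
      finally show ?thesis .
    qed
    ultimately have "dist (u p) (u z) \<le> L * dist p z" "dist (u z) (u q) \<le> L * dist z q"
      using small Suc.IH Suc.prems \<open>z \<in> S\<close> by auto
    moreover have "L * dist p z + L * dist z q = L * dist p q"
      unfolding pz zq by (simp add: algebra_simps)
    ultimately show ?case
      using dist_triangle[of "u p" "u q" "u z"] by linarith
  qed
  fix p q assume "p \<in> S" "q \<in> S"
  moreover obtain n where "dist p q / \<delta> \<le> real n"
    using real_arch_simple by blast
  ultimately show "dist (u p) (u q) \<le> L * dist p q"
    using * \<delta> by (simp add: pos_divide_le_eq)
qed (rule L)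

locale coarse_height =
  fixes f :: "'b::euclidean_space \<Rightarrow> 'a::metric_space" and L \<delta> :: real and K :: "'b set"
  assumes lip: "L-lipschitz_on UNIV f" and \<delta>: "0 < \<delta>" and K: "K \<noteq> {}"
begin

definition subordinate :: "('b \<Rightarrow> real) \<Rightarrow> bool" where
  "subordinate u \<longleftrightarrow> (\<forall>k\<in>K. u k \<le> 0) \<and>
     (\<forall>p q. dist p q \<le> \<delta> \<longrightarrow> \<bar>u p - u q\<bar> \<le> dist (f p) (f q))"

text \<open>By duality the supremum is the infimum over all chains from \<open>p\<close> to \<open>K\<close> with steps of
  length at most \<open>\<delta>\<close>, each step measured in the metric pulled back by \<open>f\<close>.\<close>

definition height :: "'b \<Rightarrow> real" where
  "height p = (SUP u\<in>Collect subordinate. u p)"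

lemma L_nonneg: "0 \<le> L"
  using lip by (rule lipschitz_on_nonneg)

lemma f_dist: "dist (f p) (f q) \<le> L * dist p q"
  using lip by (simp add: lipschitz_on_def)

lemma subordinate_lipschitz:
  assumes "subordinate u"
  shows "L-lipschitz_on UNIV u"
proof (rule lipschitz_on_if_small_scale[OF convex_UNIV L_nonneg \<delta>])
  fix p q :: 'b assume "dist p q \<le> \<delta>"
  then show "dist (u p) (u q) \<le> L * dist p q"
    using assms f_dist[of p q] by (force simp: subordinate_def dist_real_def)
qed

lemma subordinate_le_height:
  assumes "subordinate u"
  shows "u p \<le> height p"
  unfolding height_def
proof (rule cSUP_upper)
  obtain k where k: "k \<in> K" using K by blast
  have "v p \<le> L * dist p k" if "subordinate v" for v
  proof -
    have "dist (v p) (v k) \<le> L * dist p k"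
      using subordinate_lipschitz[OF that] by (rule lipschitz_onD) auto
    then show ?thesis
      using that k by (auto simp: subordinate_def dist_real_def)
  qed
  then show "bdd_above ((\<lambda>u. u p) ` Collect subordinate)"
    by (intro bdd_aboveI2[where M="L * dist p k"]) simp
qed (use assms in simp)

lemma subordinate_zero: "subordinate (\<lambda>_. 0)"
  by (simp add: subordinate_def)

lemma height_nonneg: "0 \<le> height p"
  using subordinate_le_height[OF subordinate_zero] .

lemma height_least: "(\<And>u. subordinate u \<Longrightarrow> u p \<le> c) \<Longrightarrow> height p \<le> c"
  unfolding height_def using subordinate_zero by (intro cSUP_least) auto

lemma subordinate_height: "subordinate height"
proof -
  have "height p \<le> height q + dist (f p) (f q)" if "dist p q \<le> \<delta>" for p q
  proof (rule height_least)
    fix u assume u: "subordinate u"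
    then have "\<bar>u p - u q\<bar> \<le> dist (f p) (f q)"
      using that by (simp add: subordinate_def)
    then show "u p \<le> height q + dist (f p) (f q)"
      using subordinate_le_height[OF u, of q] by linarith
  qed
  then have "\<bar>height p - height q\<bar> \<le> dist (f p) (f q)" if "dist p q \<le> \<delta>" for p q
    using that by (smt (verit) dist_commute)
  moreover have "height k \<le> 0" if "k \<in> K" for k
    using that by (intro height_least) (simp add: subordinate_def)
  ultimately show ?thesis
    by (simp add: subordinate_def)
qed

lemma height_diff_le: "dist p q \<le> \<delta> \<Longrightarrow> \<bar>height p - height q\<bar> \<le> dist (f p) (f q)"
  using subordinate_height by (simp add: subordinate_def)

lemma height_zero: "k \<in> K \<Longrightarrow> height k = 0"
  using subordinate_height height_nonneg[of k] by (auto simp: subordinate_def intro: antisym)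

lemma continuous_height: "continuous_on S height"
  using lipschitz_on_continuous_on[OF subordinate_lipschitz[OF subordinate_height]]
  by (rule continuous_on_subset) simp

lemma dist_sub_le_height:
  assumes "\<And>k. k \<in> K \<Longrightarrow> dist (f k) y \<le> c"
  shows "dist (f p) y - c \<le> height p"
proof (rule subordinate_le_height)
  show "subordinate (\<lambda>p. dist (f p) y - c)"
    using assms by (auto simp: subordinate_def dist_commute[of _ y])
      (metis abs_dist_diff_le dist_commute)
qed

text \<open>If the level set \<open>C\<close> separates \<open>a\<close> from \<open>K\<close> and \<open>f = y\<close> on \<open>C\<close>, then raising the height
  beyond \<open>C\<close> to \<open>r + dist (f p) y\<close>, up to an error of the order of \<open>\<delta>\<close>, keeps it subordinate, so
  maximality of the height bounds \<open>dist (f a) y\<close>.\<close>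

lemma dist_separating_level:
  assumes C: "\<And>p. p \<in> C \<Longrightarrow> height p = r" "\<And>p. p \<in> C \<Longrightarrow> f p = y"
    and sep: "\<And>k. k \<in> K \<Longrightarrow> \<not> connected_component (- C) a k"
    and a: "a \<notin> C"
  shows "dist (f a) y \<le> height a - r + 2 * L * \<delta>"
proof -
  define V where "V = connected_component_set (- C) a"
  define u where "u p = (if p \<in> V then max (height p) (r + dist (f p) y - 2 * L * \<delta>) else height p)" for p
  have jump: "u p = height p" if "p \<in> V" "q \<notin> V" "dist p q \<le> \<delta>" for p q
  proof -
    have "\<exists>z\<in>closed_segment p q. z \<in> C"
    proof (rule ccontr)
      assume "\<not> ?thesis"
      then have "connected_component (- C) p q"
        by (intro connected_componentI[of "closed_segment p q"]) auto
      then show False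
        using that connected_component_trans unfolding V_def by fastforce
    qed
    then obtain z where z: "z \<in> closed_segment p q" "z \<in> C" by blast
    then have "dist p z \<le> \<delta>"
      using segment_bound(1)[OF z(1)] that(3) by (simp add: dist_norm norm_minus_commute)
    moreover have "L * dist p z \<le> L * \<delta>"
      using calculation L_nonneg by (rule mult_left_mono)
    ultimately have "\<bar>height p - r\<bar> \<le> L * \<delta>" "dist (f p) y \<le> L * \<delta>"
      using height_diff_le[of p z] f_dist[of p z] C z(2) by auto
    then show ?thesis by (simp add: u_def)
  qed
  have max_diff: "\<bar>max (a::real) b - max a' b'\<bar> \<le> c" if "\<bar>a - a'\<bar> \<le> c" "\<bar>b - b'\<bar> \<le> c" for a b a' b' c
    using that by (auto simp: max_def)
  have "subordinate u"
    unfolding subordinate_def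
  proof (intro conjI ballI allI impI)
    fix k assume "k \<in> K"
    then show "u k \<le> 0" using sep by (simp add: u_def V_def height_zero)
  next
    fix p q :: 'b assume pq: "dist p q \<le> \<delta>"
    then have h: "\<bar>height p - height q\<bar> \<le> dist (f p) (f q)" by (rule height_diff_le)
    consider "p \<in> V" "q \<in> V" | "u p = height p" "u q = height q"
      using jump[of p q] jump[of q p] pq by (cases "p \<in> V"; cases "q \<in> V") (auto simp: u_def dist_commute)
    then show "\<bar>u p - u q\<bar> \<le> dist (f p) (f q)"
    proof cases
      case 1
      have "\<bar>dist (f p) y - dist (f q) y\<bar> \<le> dist (f p) (f q)"
        using abs_dist_diff_le[of "f p" y "f q"] by (simp add: dist_commute)
      with h 1 show ?thesis unfolding u_def by (auto intro!: max_diff)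
    qed (use h in simp)
  qed
  moreover have "a \<in> V" using a by (simp add: V_def)
  ultimately show ?thesis
    using subordinate_le_height[of u a] by (simp add: u_def)
qed

lemma dist_le_heights_minus_positive_min:
  assumes null: "hausdorff_measure 2 (range f) = 0"
    and K': "connected K" and A: "connected A" "a \<in> A" "b \<in> A"
    and m: "0 < m" "\<And>p. p \<in> A \<Longrightarrow> m \<le> height p"
  shows "dist (f a) (f b) \<le> height a + height b - 2 * m + 4 * L * \<delta>"
proof (rule field_le_epsilon)
  fix e :: real assume e: "0 < e"
  have "AE r in lborel. \<forall>C. connected C \<and> C \<subseteq> {p. height p = r} \<longrightarrow> f constant_on C"
    using null lipschitz_on_continuous_on[OF lip] \<delta> height_diff_le by (rule AE_level_set_constant)
  then obtain N where N: "N \<in> null_sets lborel"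
    "{r. \<not> (\<forall>C. connected C \<and> C \<subseteq> {p. height p = r} \<longrightarrow> f constant_on C)} \<subseteq> N"
    unfolding eventually_ae_filter by auto
  have "\<not> {max 0 (m - e / 2)<..<m} \<subseteq> N"
  proof
    assume "{max 0 (m - e / 2)<..<m} \<subseteq> N"
    then have "emeasure lborel {max 0 (m - e / 2)<..<m} = 0"
      using null_sets_subset[OF N(1)] by (metis null_setsD1 greaterThanLessThan_borel sets_lborel)
    then show False using m e by (simp add: max_def split: if_splits)
  qed
  then obtain r where r': "r \<in> {max 0 (m - e / 2)<..<m}" "r \<notin> N"
    by blast
  then have r: "0 < r" "m - e / 2 < r" "r < m"
    by auto
  have const: "\<And>C. connected C \<Longrightarrow> C \<subseteq> {p. height p = r} \<Longrightarrow> f constant_on C"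
    using r'(2) N(2) by blast
  define E where "E = {p. height p = r}"
  have "closed E"
    unfolding E_def by (intro closed_Collect_eq continuous_height continuous_on_const)
  obtain k where k: "k \<in> K" using K by blast
  have "\<not> connected_component (- E) a k"
  proof
    assume "connected_component (- E) a k"
    then obtain T where T: "connected T" "T \<subseteq> - E" "a \<in> T" "k \<in> T"
      by (auto simp: connected_component_def)
    have "connected (height ` T)"
      using T(1) by (intro connected_continuous_image continuous_height)
    moreover have "height k < r" "r < height a"
      using r k m(2)[OF A(2)] by (auto simp: height_zero)
    ultimately have "r \<in> height ` T"
      using connected_contains_Icc[of "height ` T" "height k" "height a"] T by auto
    then show False using T(2) by (auto simp: E_def)
  qed
  then obtain C where C: "C \<in> components E" and sepC: "\<not> connected_component (- C) a k"
    using separation_by_component_closed_pointwise[OF \<open>closed E\<close>] by blast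
  have CE: "C \<subseteq> E" "connected C"
    using C by (auto dest: in_components_subset in_components_connected)
  obtain y where y: "\<And>p. p \<in> C \<Longrightarrow> f p = y"
    using const[of C] CE unfolding constant_on_def E_def by blast
  have KC: "K \<subseteq> - C" and AC: "A \<subseteq> - C"
    using CE(1) r m(2) by (force simp: E_def height_zero)+
  have sep: "\<not> connected_component (- C) c k'" if "k' \<in> K" "c \<in> A" for c k'
  proof
    assume "connected_component (- C) c k'"
    moreover have "connected_component (- C) k' k" "connected_component (- C) a c"
      using connected_componentI[OF K' KC] connected_componentI[OF A(1) AC] that k A by auto
    ultimately show False
      using sepC connected_component_trans by metis
  qed
  have "dist (f c) y \<le> height c - r + 2 * L * \<delta>" if "c \<in> A" for c
    using CE(1) y sep that AC by (intro dist_separating_level[of C]) (auto simp: E_def)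
  from this[OF A(2)] this[OF A(3)] show "dist (f a) (f b) \<le> height a + height b - 2 * m + 4 * L * \<delta> + e"
    using dist_triangle2[of "f a" "f b" y] r by linarith
qed

lemma dist_le_heights_minus_min:
  assumes null: "hausdorff_measure 2 (range f) = 0"
    and K': "connected K" and A: "connected A" "a \<in> A" "b \<in> A"
    and m: "\<And>p. p \<in> A \<Longrightarrow> m \<le> height p"
    and c: "\<And>k. k \<in> K \<Longrightarrow> dist (f k) x \<le> c"
  shows "dist (f a) (f b) \<le> height a + height b - 2 * m + 4 * L * \<delta> + 2 * c"
proof -
  have "0 \<le> c"
    using K c zero_le_dist order_trans by blast
  have "0 \<le> L * \<delta>" using L_nonneg \<delta> by simp
  show ?thesis
  proof (cases "0 < m")
    case True
    then show ?thesis
      using dist_le_heights_minus_positive_min[OF null K' A _ m] \<open>0 \<le> c\<close> by simp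
  next
    case False
    have "dist (f p) x - c \<le> height p" for p
      using c by (rule dist_sub_le_height)
    from this[of a] this[of b] show ?thesis
      using dist_triangle2[of "f a" "f b" x] False \<open>0 \<le> L * \<delta>\<close> by linarith
  qed
qed

end

lemma lipschitz_homotopic_sym:
  assumes "lipschitz_homotopic \<gamma> \<gamma>'"
  shows "lipschitz_homotopic \<gamma>' \<gamma>"
proof -
  obtain H where H: "lipschitz_square H"
    "\<And>t. t \<in> {0..1} \<Longrightarrow> H (t, 0) = \<gamma> t" "\<And>t. t \<in> {0..1} \<Longrightarrow> H (t, 1) = \<gamma>' t"
    "\<And>s. s \<in> {0..1} \<Longrightarrow> H (0, s) = \<gamma> 0" "\<And>s. s \<in> {0..1} \<Longrightarrow> H (1, s) = \<gamma> 1"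
    using assms unfolding lipschitz_homotopic_def by blast
  obtain L where L: "0 \<le> L" and lip: "\<And>t s t' s'. t \<in> {0..1} \<Longrightarrow> s \<in> {0..1} \<Longrightarrow> t' \<in> {0..1} \<Longrightarrow> s' \<in> {0..1} \<Longrightarrow>
      dist (H (t, s)) (H (t', s')) \<le> L * (\<bar>t - t'\<bar> + \<bar>s - s'\<bar>)"
    using H(1) unfolding lipschitz_square_def by blast
  define G where "G p = H (fst p, 1 - snd p)" for p
  have "lipschitz_square G"
    unfolding lipschitz_square_def
  proof (intro exI[of _ L] conjI ballI L)
    fix t s t' s' :: real assume "t \<in> {0..1}" "s \<in> {0..1}" "t' \<in> {0..1}" "s' \<in> {0..1}"
    then show "dist (G (t, s)) (G (t', s')) \<le> L * (\<bar>t - t'\<bar> + \<bar>s - s'\<bar>)"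
      using lip[of t "1 - s" t' "1 - s'"] by (simp add: G_def abs_minus_commute)
  qed
  then show ?thesis
    using assms H(2-) unfolding lipschitz_homotopic_def by (auto intro!: exI[of _ G] simp: G_def)
qed

lemma lipschitz_homotopic_trans:
  assumes "lipschitz_homotopic \<gamma>1 \<gamma>2" "lipschitz_homotopic \<gamma>2 \<gamma>3"
  shows "lipschitz_homotopic \<gamma>1 \<gamma>3"
proof -
  obtain H where H: "lipschitz_square H"
    "\<And>t. t \<in> {0..1} \<Longrightarrow> H (t, 0) = \<gamma>1 t" "\<And>t. t \<in> {0..1} \<Longrightarrow> H (t, 1) = \<gamma>2 t"
    "\<And>s. s \<in> {0..1} \<Longrightarrow> H (0, s) = \<gamma>1 0" "\<And>s. s \<in> {0..1} \<Longrightarrow> H (1, s) = \<gamma>1 1"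
    using assms(1) unfolding lipschitz_homotopic_def by blast
  obtain L where L: "0 \<le> L" and lipH: "\<And>t s t' s'. t \<in> {0..1} \<Longrightarrow> s \<in> {0..1} \<Longrightarrow> t' \<in> {0..1} \<Longrightarrow> s' \<in> {0..1} \<Longrightarrow>
      dist (H (t, s)) (H (t', s')) \<le> L * (\<bar>t - t'\<bar> + \<bar>s - s'\<bar>)"
    using H(1) unfolding lipschitz_square_def by blast
  obtain G where G: "lipschitz_square G"
    "\<And>t. t \<in> {0..1} \<Longrightarrow> G (t, 0) = \<gamma>2 t" "\<And>t. t \<in> {0..1} \<Longrightarrow> G (t, 1) = \<gamma>3 t"
    "\<And>s. s \<in> {0..1} \<Longrightarrow> G (0, s) = \<gamma>2 0" "\<And>s. s \<in> {0..1} \<Longrightarrow> G (1, s) = \<gamma>2 1"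
    using assms(2) unfolding lipschitz_homotopic_def by blast
  obtain M where M: "0 \<le> M" and lipG: "\<And>t s t' s'. t \<in> {0..1} \<Longrightarrow> s \<in> {0..1} \<Longrightarrow> t' \<in> {0..1} \<Longrightarrow> s' \<in> {0..1} \<Longrightarrow>
      dist (G (t, s)) (G (t', s')) \<le> M * (\<bar>t - t'\<bar> + \<bar>s - s'\<bar>)"
    using G(1) unfolding lipschitz_square_def by blast
  define F where "F p = (if snd p \<le> 1/2 then H (fst p, 2 * snd p) else G (fst p, 2 * snd p - 1))" for p
  define N where "N = 2 * (L + M)"
  have N: "0 \<le> N" using L M by (simp add: N_def)
  have NL: "L * (a + 2 * b) \<le> N * (a + b)" and NM: "M * (a + 2 * b) \<le> N * (a + b)"
    if "0 \<le> a" "0 \<le> b" for a b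
    using that L M by (simp_all add: N_def algebra_simps add_nonneg_nonneg)
  have lower: "dist (F (t, s)) (F (t', s')) \<le> N * (\<bar>t - t'\<bar> + \<bar>s - s'\<bar>)"
    if "t \<in> {0..1}" "t' \<in> {0..1}" "s \<in> {0..1/2}" "s' \<in> {0..1/2}" for t t' s s'
  proof -
    have "dist (F (t, s)) (F (t', s')) \<le> L * (\<bar>t - t'\<bar> + \<bar>2 * s - 2 * s'\<bar>)"
      using lipH[of t "2 * s" t' "2 * s'"] that by (simp add: F_def)
    also have "\<bar>2 * s - 2 * s'\<bar> = 2 * \<bar>s - s'\<bar>" by (simp add: abs_if)
    finally show ?thesis using NL[of "\<bar>t - t'\<bar>" "\<bar>s - s'\<bar>"] by simp
  qed
  have F_half: "F (t, s) = G (t, 2 * s - 1)" if "t \<in> {0..1}" "1/2 \<le> s" for t s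
  proof (cases "s = 1/2")
    case True
    show ?thesis unfolding True using that G(2)[of t] H(3)[of t] by (simp add: F_def)
  qed (use that in \<open>simp add: F_def\<close>)
  have upper: "dist (F (t, s)) (F (t', s')) \<le> N * (\<bar>t - t'\<bar> + \<bar>s - s'\<bar>)"
    if "t \<in> {0..1}" "t' \<in> {0..1}" "s \<in> {1/2..1}" "s' \<in> {1/2..1}" for t t' s s'
  proof -
    have "dist (F (t, s)) (F (t', s')) \<le> M * (\<bar>t - t'\<bar> + \<bar>(2 * s - 1) - (2 * s' - 1)\<bar>)"
      using lipG[of t "2 * s - 1" t' "2 * s' - 1"] that by (simp add: F_half)
    also have "\<bar>(2 * s - 1) - (2 * s' - 1)\<bar> = 2 * \<bar>s - s'\<bar>" by (simp add: abs_if)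
    finally show ?thesis using NM[of "\<bar>t - t'\<bar>" "\<bar>s - s'\<bar>"] by simp
  qed
  have mixed: "dist (F (t, s)) (F (t', s')) \<le> N * (\<bar>t - t'\<bar> + \<bar>s - s'\<bar>)"
    if "t \<in> {0..1}" "t' \<in> {0..1}" "s \<in> {0..1/2}" "s' \<in> {1/2..1}" for t t' s s'
  proof -
    have "dist (F (t, s)) (F (t', s')) \<le> N * (\<bar>t - t\<bar> + \<bar>s - 1/2\<bar>) + N * (\<bar>t - t'\<bar> + \<bar>1/2 - s'\<bar>)"
      using lower[of t t s "1/2"] upper[of t t' "1/2" s'] that
        dist_triangle[of "F (t, s)" "F (t', s')" "F (t, 1/2)"] by simp
    also have "\<dots> = N * (\<bar>t - t'\<bar> + \<bar>s - s'\<bar>)"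
      using that by (simp add: algebra_simps)
    finally show ?thesis .
  qed
  have "lipschitz_square F"
    unfolding lipschitz_square_def
  proof (intro exI[of _ N] conjI ballI N)
    fix t s t' s' :: real assume *: "t \<in> {0..1}" "s \<in> {0..1}" "t' \<in> {0..1}" "s' \<in> {0..1}"
    consider "s \<le> 1/2" "s' \<le> 1/2" | "1/2 \<le> s" "1/2 \<le> s'" | "s \<le> 1/2" "1/2 \<le> s'" | "1/2 \<le> s" "s' \<le> 1/2"
      by linarith
    then show "dist (F (t, s)) (F (t', s')) \<le> N * (\<bar>t - t'\<bar> + \<bar>s - s'\<bar>)"
      using * lower[of t t' s s'] upper[of t t' s s'] mixed[of t t' s s'] mixed[of t' t s' s]
      by cases (simp_all add: dist_commute abs_minus_commute)
  qed
  moreover have "\<gamma>1 0 = \<gamma>2 0" "\<gamma>1 1 = \<gamma>2 1"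
    using assms(1) by (simp_all add: lipschitz_homotopic_def)
  then have "(\<forall>t\<in>{0..1}. F (t, 0) = \<gamma>1 t \<and> F (t, 1) = \<gamma>3 t) \<and>
    (\<forall>s\<in>{0..1}. F (0, s) = \<gamma>1 0 \<and> F (1, s) = \<gamma>1 1)"
    using H(2-) G(2-) by (auto simp: F_def)
  ultimately show ?thesis
    using assms unfolding lipschitz_homotopic_def by auto
qed

lemma lipschitz_class_eq:
  assumes "lipschitz_homotopic \<gamma> \<gamma>'"
  shows "lipschitz_class \<gamma> = lipschitz_class \<gamma>'"
  using assms lipschitz_homotopic_sym lipschitz_homotopic_trans unfolding lipschitz_class_def by blast

text \<open>The height \<open>h\<close> turns the unit interval into a rooted tree through which \<open>\<alpha>\<close> factors. The null
  homotopy cuts the tree off at height \<open>C s\<close>: it moves \<open>\<alpha> t\<close> to \<open>\<alpha> (\<tau> t (C s))\<close>, where \<open>\<tau> t \<sigma>\<close> is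
  the last time before \<open>t\<close> at which the height is at most \<open>\<sigma>\<close>.\<close>

lemma lipschitz_null_homotopic_if_tree_like:
  fixes \<alpha> :: "real \<Rightarrow> 'a::metric_space" and h :: "real \<Rightarrow> real"
  assumes path: "lipschitz_path \<alpha>" and h: "C-lipschitz_on {0..1} h"
    and h01: "h 0 = 0" "h 1 = 0" and nonneg: "\<And>t. t \<in> {0..1} \<Longrightarrow> 0 \<le> h t"
    and tree: "\<And>s t m. 0 \<le> s \<Longrightarrow> s \<le> t \<Longrightarrow> t \<le> 1 \<Longrightarrow> (\<And>u. u \<in> {s..t} \<Longrightarrow> m \<le> h u) \<Longrightarrow>
      dist (\<alpha> s) (\<alpha> t) \<le> h s + h t - 2 * m"
  shows "lipschitz_homotopic (\<lambda>_. \<alpha> 0) \<alpha>"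
proof -
  have C: "0 \<le> C" using h by (rule lipschitz_on_nonneg)
  have hC: "\<bar>h s - h t\<bar> \<le> C * \<bar>s - t\<bar>" if "s \<in> {0..1}" "t \<in> {0..1}" for s t
    using lipschitz_onD[OF h that] by (simp add: dist_real_def)
  have conth: "continuous_on {0..1} h" using h by (rule lipschitz_on_continuous_on)
  define \<tau> where "\<tau> t \<sigma> = Sup {u \<in> {0..t}. h u \<le> \<sigma>}" for t \<sigma>
  have \<tau>: "0 \<le> \<tau> t \<sigma>" "\<tau> t \<sigma> \<le> t" "h (\<tau> t \<sigma>) \<le> \<sigma>" "\<And>u. u \<in> {0..t} \<Longrightarrow> h u \<le> \<sigma> \<Longrightarrow> u \<le> \<tau> t \<sigma>"
    if "t \<in> {0..1}" "0 \<le> \<sigma>" for t \<sigma>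
  proof -
    let ?S = "{u \<in> {0..t}. h u \<le> \<sigma>}"
    have "continuous_on {0..t} h" using conth by (rule continuous_on_subset) (use that in auto)
    then have "closed ?S"
      using continuous_on_closed_Collect_le[of "{0..t}" h "\<lambda>_. \<sigma>"] by auto
    moreover have "0 \<in> ?S" using that h01 by auto
    moreover have bdd: "bdd_above ?S" by (rule bdd_aboveI[of _ t]) auto
    ultimately have "\<tau> t \<sigma> \<in> ?S"
      unfolding \<tau>_def by (intro closed_contains_Sup) auto
    then show "0 \<le> \<tau> t \<sigma>" "\<tau> t \<sigma> \<le> t" "h (\<tau> t \<sigma>) \<le> \<sigma>" by auto
    show "u \<le> \<tau> t \<sigma>" if "u \<in> {0..t}" "h u \<le> \<sigma>" for u
      unfolding \<tau>_def using that bdd by (intro cSup_upper) auto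
  qed
  have \<tau>_self: "\<tau> t \<sigma> = t" if "t \<in> {0..1}" "h t \<le> \<sigma>" for t \<sigma>
    using \<tau>[of t \<sigma>] nonneg[of t] that by (intro antisym) auto
  have h\<tau>: "h (\<tau> t \<sigma>) = min \<sigma> (h t)" if t\<sigma>: "t \<in> {0..1}" "0 \<le> \<sigma>" for t \<sigma>
  proof (cases "h t \<le> \<sigma>")
    case False
    have "continuous_on {\<tau> t \<sigma>..t} h"
      using conth by (rule continuous_on_subset) (use \<tau>[OF t\<sigma>] t\<sigma> in auto)
    then obtain u where "\<tau> t \<sigma> \<le> u" "u \<le> t" "h u = \<sigma>"
      using IVT'[of h "\<tau> t \<sigma>" \<sigma> t] \<tau>[OF t\<sigma>] False by auto
    then show ?thesis
      using \<tau>[OF t\<sigma>] False by (metis atLeastAtMost_iff dual_order.trans min.absorb1 nle_le order_refl)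
  qed (use \<tau>_self t\<sigma> in auto)
  have above: "min \<sigma> (h t) \<le> h u" if "t \<in> {0..1}" "0 \<le> \<sigma>" "u \<in> {\<tau> t \<sigma>..t}" for t \<sigma> u
  proof (cases "h u \<le> \<sigma>")
    case True
    then have "u = \<tau> t \<sigma>" using \<tau>[OF that(1,2)] that(3) by (intro antisym) auto
    then show ?thesis using h\<tau>[OF that(1,2)] by simp
  qed simp
  have moveT: "dist (\<alpha> (\<tau> t \<sigma>)) (\<alpha> (\<tau> t' \<sigma>)) \<le> 3 * C * \<bar>t - t'\<bar>"
    if t: "t \<in> {0..1}" "t' \<in> {0..1}" "t \<le> t'" and \<sigma>: "0 \<le> \<sigma>" for t t' \<sigma>
  proof (cases "\<tau> t' \<sigma> \<le> t")
    case True
    have "\<tau> t \<sigma> = \<tau> t' \<sigma>"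
      using \<tau>[of t \<sigma>] \<tau>[of t' \<sigma>] t \<sigma> True by (intro antisym) auto
    then show ?thesis using C by simp
  next
    case False
    let ?m = "min \<sigma> (h t) - C * (t' - t)"
    have "?m \<le> h u" if u: "u \<in> {\<tau> t \<sigma>..\<tau> t' \<sigma>}" for u
    proof (cases "u \<le> t")
      case True
      have "0 \<le> C * (t' - t)" using C t by simp
      then show ?thesis using above[of t \<sigma> u] t \<sigma> u True by auto
    next
      case f: False
      have "u \<le> t'" using u \<tau>(2)[of t' \<sigma>] t \<sigma> by auto
      then have "C * (u - t) \<le> C * (t' - t)" using C by (intro mult_left_mono) auto
      moreover have "\<bar>h u - h t\<bar> \<le> C * (u - t)" using hC[of u t] t f \<open>u \<le> t'\<close> by auto
      ultimately show ?thesis by linarith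
    qed
    then have "dist (\<alpha> (\<tau> t \<sigma>)) (\<alpha> (\<tau> t' \<sigma>)) \<le> h (\<tau> t \<sigma>) + h (\<tau> t' \<sigma>) - 2 * ?m"
      using \<tau>[of t \<sigma>] \<tau>[of t' \<sigma>] t \<sigma> False by (intro tree) auto
    also have "\<dots> = min \<sigma> (h t') - min \<sigma> (h t) + 2 * (C * (t' - t))"
      using h\<tau> t \<sigma> by simp
    also have "\<dots> \<le> C * (t' - t) + 2 * (C * (t' - t))"
      using hC[of t t'] t by (auto simp: min_def)
    finally show ?thesis using t by simp
  qed
  have move\<sigma>: "dist (\<alpha> (\<tau> t \<sigma>)) (\<alpha> (\<tau> t \<sigma>')) \<le> \<sigma>' - \<sigma>"
    if t: "t \<in> {0..1}" and \<sigma>: "0 \<le> \<sigma>" "\<sigma> \<le> \<sigma>'" for t \<sigma> \<sigma>'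
  proof -
    have "dist (\<alpha> (\<tau> t \<sigma>)) (\<alpha> (\<tau> t \<sigma>')) \<le> h (\<tau> t \<sigma>) + h (\<tau> t \<sigma>') - 2 * min \<sigma> (h t)"
      using \<tau>[of t \<sigma>] \<tau>[of t \<sigma>'] t \<sigma> by (intro tree above) auto
    also have "\<dots> \<le> \<sigma>' - \<sigma>"
      using h\<tau> t \<sigma> by simp
    finally show ?thesis .
  qed
  have \<tau>0: "\<alpha> (\<tau> t 0) = \<alpha> 0" if "t \<in> {0..1}" for t
    using tree[of 0 "\<tau> t 0" 0] \<tau>[of t 0] h\<tau>[of t 0] that h01 nonneg by force
  have \<alpha>1: "\<alpha> 1 = \<alpha> 0"
    using tree[of 0 1 0] h01 nonneg by simp
  define H where "H p = \<alpha> (\<tau> (fst p) (C * snd p))" for p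
  have "lipschitz_square H"
    unfolding lipschitz_square_def
  proof (intro exI[of _ "3 * C"] conjI ballI)
    fix t s t' s' :: real assume *: "t \<in> {0..1}" "s \<in> {0..1}" "t' \<in> {0..1}" "s' \<in> {0..1}"
    then have Cs: "0 \<le> C * s" "0 \<le> C * s'" using C by auto
    have "dist (\<alpha> (\<tau> t (C * s))) (\<alpha> (\<tau> t' (C * s))) \<le> 3 * C * \<bar>t - t'\<bar>"
      using moveT[of t t' "C * s"] moveT[of t' t "C * s"] * Cs
      by (cases "t \<le> t'") (auto simp: dist_commute abs_minus_commute)
    moreover have "dist (\<alpha> (\<tau> t' (C * s))) (\<alpha> (\<tau> t' (C * s'))) \<le> C * \<bar>s - s'\<bar>"
    proof (cases "s \<le> s'")
      case True
      then show ?thesis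
        using move\<sigma>[of t' "C * s" "C * s'"] * Cs C by (simp add: mult_left_mono right_diff_distrib)
    next
      case False
      then show ?thesis
        using move\<sigma>[of t' "C * s'" "C * s"] * Cs C
        by (simp add: mult_left_mono right_diff_distrib dist_commute)
    qed
    moreover have "C * \<bar>s - s'\<bar> \<le> 3 * C * \<bar>s - s'\<bar>"
      using C by (simp add: mult_right_mono)
    ultimately show "dist (H (t, s)) (H (t', s')) \<le> 3 * C * (\<bar>t - t'\<bar> + \<bar>s - s'\<bar>)"
      using dist_triangle[of "H (t, s)" "H (t', s')" "H (t', s)"]
      unfolding H_def fst_conv snd_conv distrib_left by linarith
  qed (use C in simp)
  moreover have "H (t, 0) = \<alpha> 0 \<and> H (t, 1) = \<alpha> t" if "t \<in> {0..1}" for t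
  proof -
    have "C * t \<le> C * 1" using C that by (intro mult_left_mono) auto
    then have "h t \<le> C" using hC[of t 0] that h01 by auto
    then show ?thesis using that \<tau>0 \<tau>_self[of t C] by (simp add: H_def)
  qed
  moreover have "H (0, s) = \<alpha> 0 \<and> H (1, s) = \<alpha> 0" if "s \<in> {0..1}" for s
    using \<tau>_self[of 0 "C * s"] \<tau>_self[of 1 "C * s"] that h01 C \<alpha>1 by (simp add: H_def)
  moreover have "lipschitz_path (\<lambda>_. \<alpha> 0)"
    unfolding lipschitz_path_def by (intro exI[of _ 0] lipschitz_onI) auto
  ultimately show ?thesis
    using path \<alpha>1 unfolding lipschitz_homotopic_def by auto
qed

lemma approximate_tree_height:
  fixes \<alpha> \<beta> :: "real \<Rightarrow> 'a::metric_space"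
  assumes unrect: "purely_2_unrectifiable TYPE('a)"
    and hom: "lipschitz_homotopic \<alpha> \<beta>"
    and C: "C-lipschitz_on {0..1} \<alpha>"
    and ends: "\<alpha> 0 = x" "\<alpha> 1 = x" and e: "0 < e"
    and \<beta>: "\<And>t. t \<in> {0..1} \<Longrightarrow> dist (\<beta> t) x \<le> e"
  obtains h where "C-lipschitz_on {0..1} h" "h 0 = 0" "h 1 = 0" "\<And>t. 0 \<le> h t"
    "\<And>s t m. 0 \<le> s \<Longrightarrow> s \<le> t \<Longrightarrow> t \<le> 1 \<Longrightarrow> (\<And>u. u \<in> {s..t} \<Longrightarrow> m \<le> h u) \<Longrightarrow>
      dist (\<alpha> s) (\<alpha> t) \<le> h s + h t - 2 * m + 3 * e"
proof -
  obtain H where H: "lipschitz_square H"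
    "\<And>t. t \<in> {0..1} \<Longrightarrow> H (t, 0) = \<alpha> t" "\<And>t. t \<in> {0..1} \<Longrightarrow> H (t, 1) = \<beta> t"
    "\<And>s. s \<in> {0..1} \<Longrightarrow> H (0, s) = x" "\<And>s. s \<in> {0..1} \<Longrightarrow> H (1, s) = x"
    using hom ends unfolding lipschitz_homotopic_def by force
  obtain L where L: "0 \<le> L" and lipH: "\<And>t s t' s'. t \<in> {0..1} \<Longrightarrow> s \<in> {0..1} \<Longrightarrow> t' \<in> {0..1} \<Longrightarrow> s' \<in> {0..1} \<Longrightarrow>
      dist (H (t, s)) (H (t', s')) \<le> L * (\<bar>t - t'\<bar> + \<bar>s - s'\<bar>)"
    using H(1) unfolding lipschitz_square_def by blast
  define c :: "real \<Rightarrow> real" where "c t = max 0 (min 1 t)" for t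
  have c01: "c t \<in> {0..1}" for t by (simp add: c_def)
  have c_id: "c t = t" if "t \<in> {0..1}" for t using that by (simp add: c_def)
  have cc: "\<bar>c s - c t\<bar> \<le> \<bar>s - t\<bar>" for s t by (auto simp: c_def max_def min_def)
  define f where "f p = H (c (fst p), c (snd p))" for p
  have f1: "dist (f (t, s)) (f (t', s')) \<le> L * (\<bar>t - t'\<bar> + \<bar>s - s'\<bar>)" for t s t' s'
  proof -
    have "dist (f (t, s)) (f (t', s')) \<le> L * (\<bar>c t - c t'\<bar> + \<bar>c s - c s'\<bar>)"
      unfolding f_def fst_conv snd_conv by (intro lipH c01)
    also have "\<dots> \<le> L * (\<bar>t - t'\<bar> + \<bar>s - s'\<bar>)"
      using L cc by (intro mult_left_mono add_mono)
    finally show ?thesis .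
  qed
  have lipf: "(2 * L)-lipschitz_on UNIV f"
  proof (rule lipschitz_onI)
    fix p q :: "real \<times> real"
    have "dist (f p) (f q) \<le> L * (dist (fst p) (fst q) + dist (snd p) (snd q))"
      using f1[of "fst p" "snd p" "fst q" "snd q"] by (simp add: dist_real_def)
    also have "\<dots> \<le> L * (dist p q + dist p q)"
      using L by (intro mult_left_mono add_mono dist_fst_le dist_snd_le)
    finally show "dist (f p) (f q) \<le> 2 * L * dist p q" by simp
  qed (use L in simp)
  define f' :: "real^2 \<Rightarrow> 'a" where "f' v = f (v $ 1, v $ 2)" for v
  have "(2 * L)-lipschitz_on UNIV f'"
  proof (rule lipschitz_onI)
    fix v w :: "real^2"
    have "dist (f' v) (f' w) \<le> L * (dist (v $ 1) (w $ 1) + dist (v $ 2) (w $ 2))"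
      unfolding f'_def using f1 by (simp add: dist_real_def)
    also have "\<dots> \<le> L * (dist v w + dist v w)"
      using L by (intro mult_left_mono add_mono dist_vec_nth_le)
    finally show "dist (f' v) (f' w) \<le> 2 * L * dist v w" by simp
  qed (use L in simp)
  then have "hausdorff_measure 2 (range f') = 0"
    using unrect unfolding purely_2_unrectifiable_def by (metis sets.top space_borel)
  moreover have "range f' = range f"
  proof -
    have "f (a, b) = f' (vector [a, b])" for a b by (simp add: f'_def)
    then have "f p \<in> range f'" for p by (cases p) blast
    then show ?thesis by (auto simp: f'_def)
  qed
  ultimately have null: "hausdorff_measure 2 (range f) = 0" by simp

  define K :: "(real \<times> real) set" where "K = {..0} \<times> UNIV \<union> UNIV \<times> {1..} \<union> {1..} \<times> UNIV"
  have conK: "connected K"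
  proof -
    have "connected ({..0::real} \<times> (UNIV :: real set))" "connected ((UNIV :: real set) \<times> {1::real..})"
      "connected ({1::real..} \<times> (UNIV :: real set))"
      by (intro connected_Times; simp)+
    moreover have "({..0} \<times> UNIV) \<inter> (UNIV \<times> {1..}) \<noteq> ({} :: (real \<times> real) set)"
      "({..0} \<times> UNIV \<union> UNIV \<times> {1..}) \<inter> ({1..} \<times> UNIV) \<noteq> ({} :: (real \<times> real) set)"
      by auto
    ultimately show ?thesis
      unfolding K_def by (intro connected_Un)
  qed
  have fK: "dist (f k) x \<le> e" if k: "k \<in> K" for k
  proof -
    consider "fst k \<le> 0" | "1 \<le> snd k" | "1 \<le> fst k" using k by (auto simp: K_def)
    then show ?thesis
    proof cases
      case 1
      then have "c (fst k) = 0" by (simp add: c_def)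
      then show ?thesis using H(4) c01 e by (simp add: f_def)
    next
      case 2
      then have "c (snd k) = 1" by (simp add: c_def)
      then show ?thesis using H(3) c01 \<beta> by (simp add: f_def)
    next
      case 3
      then have "c (fst k) = 1" by (simp add: c_def)
      then show ?thesis using H(5) c01 e by (simp add: f_def)
    qed
  qed
  define \<delta> where "\<delta> = e / (8 * L + 1)"
  have \<delta>: "0 < \<delta>" using e L by (simp add: \<delta>_def)
  have "4 * (2 * L) * \<delta> \<le> e"
    using e L by (simp add: \<delta>_def divide_simps) 
  interpret coarse_height f "2 * L" \<delta> K
    using lipf \<delta> by unfold_locales (auto simp: K_def)
  have f\<alpha>: "f (t, 0) = \<alpha> t" if "t \<in> {0..1}" for t
    using H(2) that by (simp add: f_def c_id)
  show thesis
  proof (rule that[of "\<lambda>t. height (t, 0)"])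
    have "dist (height (s, 0)) (height (t, 0)) \<le> C * dist s t"
      if "s \<in> {0..1}" "t \<in> {0..1}" "dist s t \<le> \<delta>" for s t
    proof -
      have "\<bar>height (s, 0) - height (t, 0)\<bar> \<le> dist (f (s, 0)) (f (t, 0))"
        using that by (intro height_diff_le) (simp add: dist_Pair_Pair)
      also have "\<dots> \<le> C * dist s t"
        using that lipschitz_onD[OF C that(1,2)] by (simp add: f\<alpha>)
      finally show ?thesis by (simp add: dist_real_def)
    qed
    then show "C-lipschitz_on {0..1} (\<lambda>t. height (t, 0))"
      by (intro lipschitz_on_if_small_scale[OF _ lipschitz_on_nonneg[OF C] \<delta>]) auto
    show "height (0, 0) = 0" "height (1, 0) = 0"
      by (rule height_zero; simp add: K_def)+
    show "0 \<le> height (t, 0)" for t by (rule height_nonneg)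
    fix s t m :: real
    assume st: "0 \<le> s" "s \<le> t" "t \<le> 1" and m: "\<And>u. u \<in> {s..t} \<Longrightarrow> m \<le> height (u, 0)"
    have "dist (f (s, 0)) (f (t, 0)) \<le> height (s, 0) + height (t, 0) - 2 * m + 4 * (2 * L) * \<delta> + 2 * e"
    proof (rule dist_le_heights_minus_min[OF null conK _ _ _ _ fK])
      show "connected ({s..t} \<times> {0::real})" by (intro connected_Times) auto
    qed (use st m in auto)
    then show "dist (\<alpha> s) (\<alpha> t) \<le> height (s, 0) + height (t, 0) - 2 * m + 3 * e"
      using \<open>4 * (2 * L) * \<delta> \<le> e\<close> f\<alpha>[of s] f\<alpha>[of t] st by simp
  qed
qed

theorem corollary3p11:
  fixes x :: "'a::metric_space" and \<alpha> :: "real \<Rightarrow> 'a"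
  assumes "purely_2_unrectifiable TYPE('a)"
    and "lipschitz_class \<alpha> \<in> lipschitz_pi1 x"
    and "\<And>U. open U \<Longrightarrow> x \<in> U \<Longrightarrow>
           \<exists>\<alpha>\<^sub>U \<in> lipschitz_class \<alpha>. lipschitz_loop x \<alpha>\<^sub>U \<and> \<alpha>\<^sub>U ` {0..1} \<subseteq> U"
  shows "lipschitz_class \<alpha> = lipschitz_class (\<lambda>_. x)"
proof -
  have near: "\<exists>\<beta>. lipschitz_homotopic \<alpha> \<beta> \<and> lipschitz_loop x \<beta> \<and> (\<forall>t\<in>{0..1}. dist (\<beta> t) x \<le> e)"
    if "0 < e" for e
    using assms(3)[of "ball x e"] that by (fastforce simp: lipschitz_class_def dist_commute)
  obtain \<beta> where "lipschitz_homotopic \<alpha> \<beta>" "lipschitz_loop x \<beta>"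
    using near[of 1] by auto
  then have path: "lipschitz_path \<alpha>" and ends: "\<alpha> 0 = x" "\<alpha> 1 = x"
    by (auto simp: lipschitz_homotopic_def lipschitz_loop_def)
  then obtain C where C: "C-lipschitz_on {0..1} \<alpha>" unfolding lipschitz_path_def by blast
  have C0: "0 \<le> C" using C by (rule lipschitz_on_nonneg)
  define e where "e n = 1 / real (Suc n)" for n
  have "\<exists>h. C-lipschitz_on {0..1} h \<and> h 0 = 0 \<and> h 1 = 0 \<and> (\<forall>t. 0 \<le> h t) \<and>
      (\<forall>s t m. 0 \<le> s \<longrightarrow> s \<le> t \<longrightarrow> t \<le> 1 \<longrightarrow> (\<forall>u\<in>{s..t}. m \<le> h u) \<longrightarrow>
        dist (\<alpha> s) (\<alpha> t) \<le> h s + h t - 2 * m + 3 * e n)" for n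
  proof -
    have "0 < e n" by (simp add: e_def)
    obtain \<beta> where \<beta>: "lipschitz_homotopic \<alpha> \<beta>" "\<And>t. t \<in> {0..1} \<Longrightarrow> dist (\<beta> t) x \<le> e n"
      using near[OF \<open>0 < e n\<close>] by blast
    show ?thesis
      by (rule approximate_tree_height[OF assms(1) \<beta>(1) C ends \<open>0 < e n\<close> \<beta>(2)]) blast+
  qed
  then obtain h where lip: "\<And>n. C-lipschitz_on {0..1} (h n)" and h01: "\<And>n. h n 0 = 0" "\<And>n. h n 1 = 0"
    and nonneg: "\<And>n t. 0 \<le> h n t"
    and tree: "\<And>n s t m. 0 \<le> s \<Longrightarrow> s \<le> t \<Longrightarrow> t \<le> 1 \<Longrightarrow> (\<And>u. u \<in> {s..t} \<Longrightarrow> m \<le> h n u) \<Longrightarrow>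
      dist (\<alpha> s) (\<alpha> t) \<le> h n s + h n t - 2 * m + 3 * e n"
    by metis
  have hC: "\<bar>h n s - h n t\<bar> \<le> C * \<bar>s - t\<bar>" if "s \<in> {0..1}" "t \<in> {0..1}" for n s t
    using lipschitz_onD[OF lip that] by (simp add: dist_real_def)
  obtain g k where k: "strict_mono (k :: nat \<Rightarrow> nat)"
    and unif: "\<And>e. 0 < e \<Longrightarrow> \<exists>N. \<forall>n t. N \<le> n \<and> t \<in> {0..1} \<longrightarrow> norm (h (k n) t - g t) < e"
  proof (rule Arzela_Ascoli[of "{0..1::real}" h C])
    show "norm (h n t) \<le> C" if "t \<in> {0..1}" for n t
      using hC[of t 0 n] h01 that mult_left_mono[OF _ C0, of t 1] by auto
    show "\<exists>d>0. \<forall>n s. s \<in> {0..1} \<and> norm (t - s) < d \<longrightarrow> norm (h n t - h n s) < \<epsilon>"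
      if "t \<in> {0..1}" "0 < \<epsilon>" for t \<epsilon>
    proof (intro exI[of _ "\<epsilon> / (C + 1)"] conjI allI impI)
      fix n s assume s: "s \<in> {0..1} \<and> norm (t - s) < \<epsilon> / (C + 1)"
      have "\<bar>h n t - h n s\<bar> \<le> C * \<bar>t - s\<bar>" using hC that s by blast
      also have "\<dots> \<le> (C + 1) * \<bar>t - s\<bar>" by (simp add: mult_right_mono)
      also have "\<dots> < \<epsilon>" using s C0 by (simp add: field_simps)
      finally show "norm (h n t - h n s) < \<epsilon>" by simp
    qed (use C0 that in simp)
  qed auto
  have lim: "(\<lambda>n. h (k n) t) \<longlonglongrightarrow> g t" if "t \<in> {0..1}" for t
    unfolding LIMSEQ_iff using unif that by blast
  have "(\<lambda>n. e (k n)) \<longlonglongrightarrow> 0"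
    using LIMSEQ_subseq_LIMSEQ[OF LIMSEQ_Suc[OF lim_1_over_n] k] by (simp add: e_def o_def)
  have "lipschitz_homotopic (\<lambda>_. \<alpha> 0) \<alpha>"
  proof (rule lipschitz_null_homotopic_if_tree_like[OF path])
    show "C-lipschitz_on {0..1} g"
    proof (rule lipschitz_onI)
      fix s t :: real assume st: "s \<in> {0..1}" "t \<in> {0..1}"
      have "(\<lambda>n. dist (h (k n) s) (h (k n) t)) \<longlonglongrightarrow> dist (g s) (g t)"
        using st by (intro tendsto_dist lim)
      then show "dist (g s) (g t) \<le> C * dist s t"
        by (rule LIMSEQ_le_const2) (use lipschitz_onD[OF lip st] in blast)
    qed (rule C0)
    show "g 0 = 0" "g 1 = 0"
      using lim[of 0] lim[of 1] by (simp_all add: h01 LIMSEQ_const_iff)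
    show "0 \<le> g t" if "t \<in> {0..1}" for t
      using lim[OF that] by (rule LIMSEQ_le_const) (use nonneg in blast)
  next
    fix s t m :: real
    assume st: "0 \<le> s" "s \<le> t" "t \<le> 1" and m: "\<And>u. u \<in> {s..t} \<Longrightarrow> m \<le> g u"
    show "dist (\<alpha> s) (\<alpha> t) \<le> g s + g t - 2 * m"
    proof (rule field_le_epsilon)
      fix \<epsilon> :: real assume \<epsilon>: "0 < \<epsilon>"
      obtain N where N: "\<And>n u. N \<le> n \<Longrightarrow> u \<in> {0..1} \<Longrightarrow> norm (h (k n) u - g u) < \<epsilon> / 2"
        using unif[of "\<epsilon> / 2"] \<epsilon> by auto
      have "(\<lambda>n. h (k n) s + h (k n) t - 2 * (m - \<epsilon> / 2) + 3 * e (k n))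
          \<longlonglongrightarrow> g s + g t - 2 * (m - \<epsilon> / 2) + 3 * 0"
        using st by (intro tendsto_intros lim \<open>(\<lambda>n. e (k n)) \<longlonglongrightarrow> 0\<close>) auto
      moreover have "dist (\<alpha> s) (\<alpha> t) \<le> h (k n) s + h (k n) t - 2 * (m - \<epsilon> / 2) + 3 * e (k n)"
        if "N \<le> n" for n
      proof (rule tree[OF st])
        fix u assume u: "u \<in> {s..t}"
        then have "u \<in> {0..1}" using st by simp
          then have "\<bar>h (k n) u - g u\<bar> < \<epsilon> / 2" using N[OF that] by simp
          then show "m - \<epsilon> / 2 \<le> h (k n) u" using m[OF u] by linarith
      qed
      ultimately have "dist (\<alpha> s) (\<alpha> t) \<le> g s + g t - 2 * (m - \<epsilon> / 2) + 3 * 0"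
        by (intro LIMSEQ_le_const) blast+
      then show "dist (\<alpha> s) (\<alpha> t) \<le> g s + g t - 2 * m + \<epsilon>" by simp
    qed
  qed
  then show ?thesis
    using lipschitz_class_eq ends by metis
qed

end
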